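(* For all integers $i,m\geq 0$, the polynomial $\widetilde{f_i^m}(x,y)+\widetilde{f_i^m}(y,x)$ lies in the ideal of $\mathbb{Q}[x,y]$ generated by $(x+y+m)_{2m+1}$.
   Context: For a number or polynomial $\alpha$ and an integer $k\geq0$, $(\alpha)_k=\alpha(\alpha-1)\cdots(\alpha-k+1)$ (falling factorial, $(\alpha)_0=1$). For integers $i,m\geq0$ put $$f_i^m(x,y)=\int_0^x t^{2i}(t^2-x^2)^m(t^2-y^2)^m\,dt,$$ and set $p=2m+i$. Then $f_i^m(x,y)=\sum_{0\leq k\leq m}c_{m,i,k}\,x^{2p-2k+1}y^{2k}$ for uniquely determined rational constants $c_{m,i,k}$. Define $$\widetilde{f_i^m}(x,y)=\sum_{0\leq k\leq m}c_{m,i,k}\,(x+p-k)_{2p-2k+1}\,(y+p-m)_k\,(y+m-p+k-1)_k .$$ *)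

theory Defs
  imports "HOL-Analysis.Analysis" "HOL-Computational_Algebra.Polynomial"
begin

definition falling_fact :: "'a::comm_ring_1 \<Rightarrow> nat \<Rightarrow> 'a" where
  "falling_fact a k = (\<Prod>j<k. a - of_nat j)"

text \<open>The interval integral is oriented, so negative \<open>x\<close> is covered as well.\<close>

definition f_int :: "nat \<Rightarrow> nat \<Rightarrow> real \<Rightarrow> real \<Rightarrow> real" where
  "f_int m i x y = (LBINT t=0..x. t^(2*i) * (t^2 - x^2)^m * (t^2 - y^2)^m)"

text \<open>The coefficients with index \<open>k > m\<close> are set to \<open>0\<close> only to make the function
  \<open>c\<close> unique; they are never used.\<close>

definition is_f_coeffs :: "nat \<Rightarrow> nat \<Rightarrow> (nat \<Rightarrow> rat) \<Rightarrow> bool" where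
  "is_f_coeffs m i c \<longleftrightarrow>
     (\<forall>k>m. c k = 0) \<and>
     (\<forall>x y. f_int m i x y =
        (\<Sum>k\<le>m. of_rat (c k) * x^(2*(2*m+i) - 2*k + 1) * y^(2*k)))"

definition f_coeff :: "nat \<Rightarrow> nat \<Rightarrow> nat \<Rightarrow> rat" where
  "f_coeff m i = (THE c. is_f_coeffs m i c)"

lemma is_f_coeffs_exists: "\<exists>c. is_f_coeffs m i c"
proof -
  define N where "N = (\<lambda>a k. 2*i + 2*(m-a) + 2*(m-k))"
  define c :: "nat \<Rightarrow> rat" where "c = (\<lambda>k. if k > m then 0 else
     (\<Sum>a\<le>m. of_nat (m choose a) * of_nat (m choose k) * (-1)^(a+k)
         / of_nat (N a k + 1)))"
  define A :: "real \<Rightarrow> real \<Rightarrow> nat \<Rightarrow> nat \<Rightarrow> real" where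
    "A = (\<lambda>x y a k. of_nat (m choose a) * of_nat (m choose k) * (-1)^(a+k) * x^(2*a) * y^(2*k))"
  have binom: "(t^2 - x^2)^m = (\<Sum>a\<le>m. of_nat (m choose a) * (-1)^a * x^(2*a) * t^(2*(m-a)))"
    for t x :: real
  proof -
    have "(t^2 - x^2)^m = (- (x^2) + t^2)^m" by simp
    also have "\<dots> = (\<Sum>a\<le>m. of_nat (m choose a) * (-(x^2))^a * (t^2)^(m-a))"
      by (rule binomial_ring)
    also have "\<dots> = (\<Sum>a\<le>m. of_nat (m choose a) * (-1)^a * x^(2*a) * t^(2*(m-a)))"
    proof (rule sum.cong[OF refl])
      fix a
      have "(-(x^2))^a = (-1)^a * x^(2*a)"
        by (metis mult_minus1 power_mult power_mult_distrib)
      then show "of_nat (m choose a) * (-(x^2))^a * (t^2)^(m-a)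
          = of_nat (m choose a) * (-1)^a * x^(2*a) * t^(2*(m-a))"
        by (simp add: power_mult)
    qed
    finally show ?thesis .
  qed
  have integrand: "t^(2*i) * (t^2 - x^2)^m * (t^2 - y^2)^m = (\<Sum>a\<le>m. \<Sum>k\<le>m. A x y a k * t^N a k)"
    for t x y :: real
  proof -
    have "t^(2*i) * ((t^2 - x^2)^m * (t^2 - y^2)^m) = (\<Sum>a\<le>m. \<Sum>k\<le>m. A x y a k * t^N a k)"
      unfolding binom sum_product unfolding sum_distrib_left
      by (intro sum.cong refl) (simp add: A_def N_def power_add mult_ac)
    then show ?thesis by (simp only: mult.assoc)
  qed
  have int: "f_int m i x y = (\<Sum>a\<le>m. \<Sum>k\<le>m. A x y a k * (x^(N a k + 1) / (N a k + 1)))" for x y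
  proof -
    define F where "F = (\<lambda>t::real. \<Sum>a\<le>m. \<Sum>k\<le>m. A x y a k * (t^(N a k + 1) / (N a k + 1)))"
    have der: "(F has_real_derivative (\<Sum>a\<le>m. \<Sum>k\<le>m. A x y a k * t^N a k)) (at t within S)" for t S
    proof -
      have 1: "((\<lambda>t::real. t^(n+1) / real (n+1)) has_real_derivative t^n) (at t within S)" for n
        by (rule derivative_eq_intros refl | simp)+
      show ?thesis unfolding F_def
        using 1 by (intro DERIV_sum DERIV_cmult) (simp add: add.commute)
    qed
    have "(LBINT t=ereal 0..ereal x. t^(2*i) * (t^2 - x^2)^m * (t^2 - y^2)^m) = F x - F 0"
      unfolding integrand
    proof (rule interval_integral_FTC_finite)
      show "continuous_on {min 0 x..max 0 x} (\<lambda>t. \<Sum>a\<le>m. \<Sum>k\<le>m. A x y a k * t ^ N a k)"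
        by (intro continuous_intros)
    qed (use der in \<open>simp add: has_real_derivative_iff_has_vector_derivative\<close>)
    moreover have "F 0 = 0" by (simp add: F_def)
    ultimately show ?thesis by (simp add: f_int_def F_def zero_ereal_def)
  qed
  have "f_int m i x y = (\<Sum>k\<le>m. of_rat (c k) * x^(2*(2*m+i) - 2*k + 1) * y^(2*k))" for x y
  proof -
    have "f_int m i x y = (\<Sum>k\<le>m. \<Sum>a\<le>m. A x y a k * (x^(N a k + 1) / (N a k + 1)))"
      unfolding int by (rule sum.swap)
    also have "\<dots> = (\<Sum>k\<le>m. of_rat (c k) * x^(2*(2*m+i) - 2*k + 1) * y^(2*k))"
    proof (rule sum.cong[OF refl])
      fix k assume "k \<in> {..m}"
      then have k: "k \<le> m" by simp
      have crat: "of_rat (c k) = (\<Sum>a\<le>m. of_nat (m choose a) * of_nat (m choose k) * (-1)^(a+k)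
         / real (N a k + 1))"
        using k by (simp add: c_def of_rat_sum of_rat_divide of_rat_mult of_rat_power
            of_rat_add of_rat_minus)
      have pw: "x^(2*(2*m+i) - 2*k + 1) = x^(2*a) * x^(N a k + 1)" if "a \<le> m" for a
      proof -
        have "2*(2*m+i) - 2*k + 1 = 2*a + (N a k + 1)"
          using that k by (simp add: N_def)
        then show ?thesis by (simp only: power_add)
      qed
      show "(\<Sum>a\<le>m. A x y a k * (x^(N a k + 1) / (N a k + 1)))
          = of_rat (c k) * x^(2*(2*m+i) - 2*k + 1) * y^(2*k)"
        unfolding crat sum_distrib_right
      proof (rule sum.cong[OF refl])
        fix a assume "a \<in> {..m}"
        then have "x^(2*(2*m+i) - 2*k + 1) = x^(2*a) * x^(N a k + 1)"
          using pw by simp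
        then show "A x y a k * (x^(N a k + 1) / (N a k + 1)) =
            of_nat (m choose a) * of_nat (m choose k) * (-1)^(a+k) / real (N a k + 1)
              * x^(2*(2*m+i) - 2*k + 1) * y^(2*k)"
          unfolding A_def by (simp only: times_divide_eq_left times_divide_eq_right mult_ac)
      qed
    qed
    finally show ?thesis .
  qed
  then have "is_f_coeffs m i c"
    by (simp add: is_f_coeffs_def c_def)
  then show ?thesis by blast
qed

lemma is_f_coeffs_unique:
  assumes c: "is_f_coeffs m i c" and d: "is_f_coeffs m i d"
  shows "c = d"
proof
  fix k
  define e :: "nat \<Rightarrow> real" where "e = (\<lambda>n. if even n then of_rat (c (n div 2)) - of_rat (d (n div 2)) else 0)"
  show "c k = d k"
  proof (cases "k \<le> m")
    case True
    have eq: "(\<Sum>k\<le>m. of_rat (c k) * y^(2*k)) = (\<Sum>k\<le>m. of_rat (d k) * y^(2*k))" for y :: real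
      using c d by (simp add: is_f_coeffs_def) (metis (no_types, lifting) mult.right_neutral power_one sum.cong)
    have "(\<Sum>n\<le>2*m. e n * y^n) = 0" for y
    proof -
      have "(\<Sum>n\<le>2*m. e n * y^n) = (\<Sum>n\<in>(\<lambda>k. 2*k) ` {..m}. e n * y^n)"
        by (rule sum.mono_neutral_right) (auto simp: e_def elim!: evenE)
      also have "\<dots> = (\<Sum>k\<le>m. e (2*k) * y^(2*k))"
        by (subst sum.reindex) (auto simp: inj_on_def)
      also have "\<dots> = 0"
        using eq[of y] by (simp add: e_def left_diff_distrib sum_subtractf)
      finally show ?thesis .
    qed
    then have "e (2*k) = 0"
      using polyfun_eq_0[of e "2*m"] True by simp
    then show ?thesis by (simp add: e_def)
  qed (use c d in \<open>simp add: is_f_coeffs_def\<close>)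
qed

lemma is_f_coeffs_f_coeff: "is_f_coeffs m i (f_coeff m i)"
  unfolding f_coeff_def using is_f_coeffs_exists is_f_coeffs_unique by (metis theI)

text \<open>The ring \<open>\<rat>[x,y]\<close> is represented as \<open>\<rat>[x][y]\<close>.\<close>

definition X :: "rat poly poly" where "X = [:[:0, 1:]:]"
definition Y :: "rat poly poly" where "Y = [:0, 1:]"

definition f_tilde :: "nat \<Rightarrow> nat \<Rightarrow> rat poly poly \<Rightarrow> rat poly poly \<Rightarrow> rat poly poly" where
  "f_tilde m i x y =
     (let p = 2*m + i in
      \<Sum>k\<le>m. [:[:f_coeff m i k:]:]
         * falling_fact (x + of_nat p - of_nat k) (2*p - 2*k + 1)
         * falling_fact (y + of_nat p - of_nat m) k
         * falling_fact (y + of_nat m - of_nat p + of_nat k - 1) k)"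

text \<open>Ideals of a commutative ring are its submodules, so the ideal generated by a set is its
  span in the ring regarded as a module over itself.\<close>

abbreviation ideal_generated :: "'a::comm_ring_1 set \<Rightarrow> 'a set" where
  "ideal_generated \<equiv> module.span (*)"

end

(*
  Write F_i^m for the polynomial f_i^m with tilde and S_i^m for its symmetrization. The divisibility
  means that S_i^m vanishes on the lines x + y = j, |j| <= m. The coefficients are beta integrals,
  and their closed form yields the recurrence
    (2i+1) F_i^{m+1} = 2(m+1) ((x^2 + y^2 - (i+1)^2 - (i+m+2)^2) F_{i+1}^m - 2 F_{i+2}^m).
  Its multipliers are symmetric in x and y, so S_i^{m+1} inherits the lines |j| <= m, and by parity
  only j = m + 1 is left. On the extreme line x + y = m, F_i^m is a product of linear factors times
  a polynomial of degree at most 2m in x. All 2m roots of this polynomial can be found: m of them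
  kill every summand, and at the m half-integers 1/2, ..., m - 1/2 it becomes an m-th difference
  of a polynomial of degree m - 1 (a case of the Pfaff-Saalschuetz summation). The resulting
  product is antisymmetric under x -> m - x.
*)
theory Submission
  imports Defs
begin

section \<open>Falling factorials\<close>

lemma falling_fact_0 [simp]: "falling_fact a 0 = 1"
  by (simp add: falling_fact_def)

lemma falling_fact_Suc: "falling_fact a (Suc k) = falling_fact a k * (a - of_nat k)"
  by (simp add: falling_fact_def)

lemma falling_fact_add: "falling_fact a (k + l) = falling_fact a k * falling_fact (a - of_nat k) l"
  by (induction l) (simp_all add: falling_fact_Suc algebra_simps)

lemma falling_fact_Suc_left: "falling_fact a (Suc k) = a * falling_fact (a - 1) k"
  using falling_fact_add[of a 1 k] by (simp add: falling_fact_Suc)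

text \<open>Negate every factor and read the product backwards. All parity and antisymmetry
  statements below come from this.\<close>

lemma falling_fact_reflect:
  "falling_fact a k = (-1) ^ k * falling_fact (of_nat k - 1 - a) k"
proof (induction k arbitrary: a)
  case (Suc k)
  have "falling_fact a (Suc k) = a * falling_fact (a - 1) k"
    by (rule falling_fact_Suc_left)
  also have "\<dots> = a * ((-1) ^ k * falling_fact (of_nat (Suc k) - 1 - a) k)"
    by (subst Suc) (simp add: algebra_simps)
  also have "\<dots> = (-1) ^ Suc k * falling_fact (of_nat (Suc k) - 1 - a) (Suc k)"
    by (simp add: falling_fact_Suc algebra_simps)
  finally show ?case .
qed simp

lemma falling_fact_eq_0:
  "j < k \<Longrightarrow> falling_fact (of_nat j :: 'a::comm_ring_1) k = 0"
  unfolding falling_fact_def by (rule prod_zero) auto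

lemma poly_falling_fact: "poly (falling_fact p k) x = falling_fact (poly p x) k"
  by (simp add: falling_fact_def poly_prod)

lemma degree_falling_fact_linear [simp]:
  "degree (falling_fact [:a, 1 :: 'a::idom:] k) = k"
proof (induction k)
  case (Suc k)
  have "[:a, 1:] - of_nat k = [:a - of_nat k, 1:]"
    by (simp add: of_nat_poly)
  moreover have "falling_fact [:a, 1:] k \<noteq> 0"
    by (simp add: falling_fact_def of_nat_poly)
  ultimately show ?case
    using Suc by (simp add: falling_fact_Suc degree_mult_eq del: mult_pCons_right)
qed simp

lemma falling_fact_linear_nonzero [simp]:
  "falling_fact [:a, 1 :: 'a::idom:] k \<noteq> 0"
  by (simp add: falling_fact_def of_nat_poly)

lemma monic_falling_fact_linear:
  "lead_coeff (falling_fact [:a, 1 :: 'a::idom:] k) = 1"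
proof -
  have "lead_coeff ([:a, 1:] - of_nat j) = 1" for j
    by (simp add: of_nat_poly)
  then show ?thesis
    unfolding falling_fact_def lead_coeff_prod by simp
qed

section \<open>Factorial analogues of odd and even powers\<close>

text \<open>Equals \<open>x * (x^2 - 1^2) * ... * (x^2 - n^2)\<close>, the analogue of
  \<open>x^(2*n+1)\<close>.\<close>

definition odd_factor :: "nat \<Rightarrow> 'a::comm_ring_1 \<Rightarrow> 'a" where
  "odd_factor n x = falling_fact (x + of_nat n) (2*n + 1)"

text \<open>The product of \<open>y^2 - (M - l)^2\<close> over \<open>l < k\<close>, the analogue of
  \<open>y^(2*k)\<close>. With \<open>M = m + i = p - m\<close> it is the pair of
  \<open>y\<close>-products in \<open>f_tilde\<close>.\<close>

definition even_factor :: "nat \<Rightarrow> nat \<Rightarrow> 'a::comm_ring_1 \<Rightarrow> 'a"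
    where
  "even_factor M k y = falling_fact (y + of_nat M) k * falling_fact (y - of_nat M + of_nat k - 1) k"

lemma odd_factor_Suc: "odd_factor (Suc n) x = (x^2 - of_nat (Suc n)^2) * odd_factor n x"
proof -
  have "odd_factor (Suc n) x = falling_fact (x + of_nat (Suc n)) (Suc (Suc (2*n + 1)))"
    by (simp add: odd_factor_def)
  also have "\<dots> = (x + of_nat (Suc n)) * (falling_fact (x + of_nat n) (2*n+1)
                     * (x + of_nat n - of_nat (2*n + 1)))"
    by (subst falling_fact_Suc_left, subst falling_fact_Suc) (simp add: algebra_simps)
  finally show ?thesis by (simp add: odd_factor_def algebra_simps power2_eq_square)
qed

lemma even_factor_0 [simp]: "even_factor M 0 y = 1"
  by (simp add: even_factor_def)

lemma even_factor_Suc: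
  assumes "k \<le> M"
  shows "even_factor M (Suc k) y = (y^2 - of_nat (M - k)^2) * even_factor M k y"
proof -
  have "falling_fact (y - of_nat M + of_nat (Suc k) - 1) (Suc k)
      = (y - of_nat (M - k)) * falling_fact (y - of_nat M + of_nat k - 1) k"
    by (subst falling_fact_Suc_left) (use assms in \<open>simp add: of_nat_diff
        algebra_simps\<close>)
  moreover have "falling_fact (y + of_nat M) (Suc k)
      = falling_fact (y + of_nat M) k * (y + of_nat (M - k))"
    using assms by (simp add: falling_fact_Suc of_nat_diff algebra_simps)
  ultimately show ?thesis
    by (simp only: even_factor_def) (simp add: algebra_simps power2_eq_square)
qed

text \<open>The new quadratic factor sits at the outer end here, but at the inner end in
  \<open>even_factor_Suc\<close>. Comparing the two expresses products with base
  \<open>Suc M\<close> through products with base \<open>M\<close>.\<close>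

lemma even_factor_Suc_Suc:
  "even_factor (Suc M) (Suc k) y = (y^2 - of_nat (Suc M)^2) * even_factor M k y"
proof -
  have "falling_fact (y + of_nat (Suc M)) (Suc k)
      = (y + of_nat (Suc M)) * falling_fact (y + of_nat M) k"
    by (subst falling_fact_Suc_left) (simp add: algebra_simps)
  moreover have "falling_fact (y - of_nat (Suc M) + of_nat (Suc k) - 1) (Suc k)
      = falling_fact (y - of_nat M + of_nat k - 1) k * (y - of_nat (Suc M))"
    by (simp add: falling_fact_Suc algebra_simps)
  ultimately show ?thesis
    by (simp only: even_factor_def) (simp add: algebra_simps power2_eq_square)
qed

lemma odd_factor_minus: "odd_factor n (-x) = - odd_factor n x"
  unfolding odd_factor_def
  by (subst falling_fact_reflect) (simp add: algebra_simps)

lemma even_factor_minus: "even_factor M k (-y) = even_factor M k y"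
proof -
  have "falling_fact (-y + of_nat M) k = (-1)^k * falling_fact (y - of_nat M + of_nat k - 1) k"
    by (subst falling_fact_reflect) (simp add: algebra_simps)
  moreover have "falling_fact (-y - of_nat M + of_nat k - 1) k
      = (-1)^k * falling_fact (y + of_nat M) k"
    by (subst falling_fact_reflect) (simp add: algebra_simps)
  ultimately show ?thesis
    by (simp add: even_factor_def mult_ac flip: power_mult_distrib)
qed

section \<open>Closed form of the coefficients\<close>

text \<open>The \<open>m + 1\<close> consecutive odd numbers from \<open>2*s + 1\<close> on: the
  denominator of the beta integral of \<open>t^(2*s) * (t^2 - x^2)^m\<close>.\<close>

definition odd_prod :: "nat \<Rightarrow> nat \<Rightarrow> 'a::comm_ring_1" where
  "odd_prod s m = (\<Prod>l\<le>m. of_nat (2*(s + l) + 1))"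

lemma odd_prod_Suc: "odd_prod s (Suc m) = odd_prod s m * of_nat (2*(s + m) + 3)"
  by (simp add: odd_prod_def algebra_simps)

lemma odd_prod_Suc_left: "odd_prod s (Suc m) = of_nat (2 * s + 1) * odd_prod (Suc s) m"
  unfolding odd_prod_def by (subst prod.atMost_Suc_shift) simp

lemma odd_prod_nonzero [simp]: "odd_prod s m \<noteq> (0 :: 'a::{idom,ring_char_0})"
  by (simp add: odd_prod_def del: of_nat_add of_nat_mult of_nat_Suc)

text \<open>Obtained by expanding \<open>(t^2 - y^2)^m\<close> and evaluating one beta integral for
  each power of \<open>y\<close>; \<open>f_coeff_eq\<close> identifies it with
  \<open>f_coeff\<close>.\<close>

definition coeff_rat :: "nat \<Rightarrow> nat \<Rightarrow> nat \<Rightarrow> rat" where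
  "coeff_rat m i k = (-1)^(k+m) * of_nat (m choose k) * fact m * 2^m / odd_prod (m + i - k) m"

text \<open>A function on the rationals, so that the argument runs pointwise;
  \<open>poly_poly_f_tilde\<close> leads back to polynomials.\<close>

definition f_tilde_rat :: "nat \<Rightarrow> nat \<Rightarrow> rat \<Rightarrow> rat
    \<Rightarrow> rat" where
  "f_tilde_rat m i x y = (\<Sum>k\<le>m. coeff_rat m i k * odd_factor (2*m
      + i - k) x * even_factor (m + i) k y)"

section \<open>The recurrence in \<open>m\<close>\<close>

lemma Suc_times_choose_Suc: "Suc k * (m choose Suc k) = (m - k) * (m choose k)"
proof (cases m)
  case (Suc n)
  then show ?thesis
    using Suc_times_binomial[of k n] binomial_absorb_comp[of m k] by (simp del: binomial_Suc_Suc)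
qed simp

text \<open>Integration by parts gives \<open>(2i+1) f_i^{m+1} = 2(m+1) ((x^2 + y^2) f_{i+1}^m - 2
  f_{i+2}^m)\<close> for the integrals; this is its coefficient form, checked on the closed forms.
  All denominators divide \<open>odd_prod s (Suc m)\<close>, which leaves an identity linear in two
  neighbouring binomial coefficients.\<close>

lemma coeff_rec:
  assumes "k \<le> Suc m"
  shows "of_nat (2*i + 1) * coeff_rat (Suc m) i k = of_nat (2*(m+1)) *
    (coeff_rat m (i+1) k + (if k = 0 then 0 else coeff_rat m (i+1) (k-1))
        - 2 * coeff_rat m (i+2) k)"
proof -
  define s where "s = Suc m + i - k"
  have k: "m + 1 - k = s - i" "i \<le> s" "k = m + 1 + i - s" "s \<le> m + 1 + i"
    using assms by (auto simp: s_def)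
  define D :: rat where "D = (-1)^(k+m) * fact m * 2^m / odd_prod s (Suc m)"
  \<comment> \<open>The case split matters because \<open>k - 1\<close> is again \<open>0\<close> at
    \<open>k = 0\<close>.\<close>
  define c' :: rat where "c' = (if k = 0 then 0 else of_nat (m choose (k-1)))"
  define c :: rat where "c = of_nat (m choose k)"
  have "of_nat (Suc m choose k) = c + c'"
    by (cases k) (simp_all add: c_def c'_def)
  then have 1: "coeff_rat (Suc m) i k = - D * (c + c') * of_nat (2*(m+1))"
    by (simp add: coeff_rat_def D_def s_def field_simps)
  have "odd_prod s (Suc m) = (odd_prod s m * of_nat (2*(s+m)+3) :: rat)"
    by (rule odd_prod_Suc)
  then have 2: "coeff_rat m (i+1) k = D * c * of_nat (2*(s+m)+3)"
    by (simp add: coeff_rat_def D_def c_def s_def del: of_nat_add of_nat_mult)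
  have o: "odd_prod s (Suc m) = (of_nat (2 * s + 1) * odd_prod (Suc s) m :: rat)"
    by (rule odd_prod_Suc_left)
  then have 3: "(if k = 0 then 0 else coeff_rat m (i+1) (k-1)) = - D * c' * of_nat (2 * s + 1)"
    using assms by (cases k) (simp_all add: coeff_rat_def D_def c'_def s_def Suc_diff_le del:
        of_nat_add of_nat_mult)
  have 4: "coeff_rat m (i+2) k = D * c * of_nat (2 * s + 1)"
    using o assms by (simp add: coeff_rat_def D_def c_def s_def Suc_diff_le del: of_nat_add
        of_nat_mult)
  \<comment> \<open>The ratio of neighbouring binomial coefficients, free of division so that it
    also covers \<open>k = 0\<close> and \<open>k = Suc m\<close>.\<close>
  have 5: "of_nat k * c = (of_nat m + 1 - of_nat k) * c'"
  proof (cases k)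
    case (Suc j)
    have "of_nat (Suc j * (m choose Suc j)) = (of_nat ((m - j) * (m choose j)) :: rat)"
      by (simp only: Suc_times_choose_Suc)
    moreover have "of_nat (m - j) = (of_nat m - of_nat j :: rat)"
      using Suc assms by (simp add: of_nat_diff)
    ultimately show ?thesis
      using Suc by (simp add: c_def c'_def algebra_simps)
  qed (simp add: c'_def)
  have s: "of_nat s = of_nat m + 1 + of_nat i - (of_nat k :: rat)"
    using assms by (simp add: s_def of_nat_diff)
  have "of_nat (2*i+1) * (- (c + c')) =
      c * of_nat (2*(s+m)+3) - c' * of_nat (2 * s + 1) - 2 * c * of_nat (2 * s + 1)"
    using 5 by (simp add: s algebra_simps)
  then have "of_nat (2*(m+1)) * D * (of_nat (2*i+1) * (- (c + c'))) = of_nat (2*(m+1)) * D *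
      (c * of_nat (2*(s+m)+3) - c' * of_nat (2 * s + 1) - 2 * c * of_nat (2 * s + 1))"
    by (rule arg_cong)
  then show ?thesis
    by (simp only: 1 2 3 4) (simp add: algebra_simps)
qed

text \<open>For factorial products, multiplication by \<open>x^2\<close> or \<open>y^2\<close> is an
  index shift plus a correction. The shifts cancel by \<open>coeff_rec\<close>, as for ordinary
  powers; the two subtracted squares are chosen so that the corrections cancel as well.\<close>

lemma f_tilde_rat_rec:
  "of_nat (2*i + 1) * f_tilde_rat (Suc m) i x y = of_nat (2*(m + 1)) *
     ((x^2 + y^2 - of_nat (i + 1)^2 - of_nat (i + m + 2)^2) * f_tilde_rat m (i + 1) x y
      - 2 * f_tilde_rat m (i + 2) x y)"
proof -
  define M where "M = m + i + 1"
  \<comment> \<open>\<open>b\<close> is the family in which \<open>f_tilde_rat (Suc m) i\<close> is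
    written, \<open>e\<close> the one for \<open>f_tilde_rat m (i + 1)\<close>. Everything is
    reduced to these two.\<close>
  define b where "b = (\<lambda>k. odd_factor (m + 1 + M - k) x * even_factor M k y)"
  define e where "e = (\<lambda>k. odd_factor (m + M - k) x * even_factor M k y)"
  define A where "A = (\<lambda>k. coeff_rat m (i+1) k)"
  define B where "B = (\<lambda>k. coeff_rat m (i+2) k)"
  define C where "C = (\<lambda>k. coeff_rat (Suc m) i k)"
  \<comment> \<open>Corrections: \<open>(y^2 - (M+1)^2) * e k = b (Suc k) + \<mu> k * e k\<close>,
    while the quadratic multiplier of the recurrence sends \<open>e k\<close> to
    \<open>b k + b (Suc k) + \<nu> k * e k\<close>.\<close>
  define \<mu> :: "nat \<Rightarrow> rat" where "\<mu>
      = (\<lambda>k. of_nat (M - k)^2 - of_nat (M + 1)^2)"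
  define \<nu> :: "nat \<Rightarrow> rat" where
    "\<nu> = (\<lambda>k. of_nat (m + 1 + M - k)^2 + of_nat (M - k)^2 - of_nat (i
        + 1)^2 - of_nat (i + m + 2)^2)"
  have bx: "x^2 * e k = b k + of_nat (m + 1 + M - k)^2 * e k" if "k \<le> m" for k
  proof -
    have "m + 1 + M - k = Suc (m + M - k)" using that by (simp add: M_def)
    then show ?thesis
      unfolding b_def e_def by (simp add: odd_factor_Suc algebra_simps)
  qed
  have by': "y^2 * e k = b (Suc k) + of_nat (M - k)^2 * e k" if "k \<le> m" for k
  proof -
    have "even_factor M (Suc k) y = (y^2 - of_nat (M - k)^2) * even_factor M k y"
      using that by (intro even_factor_Suc) (simp add: M_def)
    then show ?thesis
      by (simp only: b_def e_def) (simp add: algebra_simps)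
  qed
  have L: "f_tilde_rat (Suc m) i x y = (\<Sum>k\<le>Suc m. C k * b k)"
    unfolding f_tilde_rat_def C_def b_def M_def
        by (intro sum.cong) (simp_all add: mult.assoc mult_2 add.assoc)
  have R1: "f_tilde_rat m (i + 1) x y = (\<Sum>k\<le>m. A k * e k)"
    unfolding f_tilde_rat_def A_def e_def M_def
        by (intro sum.cong) (simp_all add: mult.assoc mult_2 add.assoc)
  have Bz: "B (Suc m) = 0" by (simp add: B_def coeff_rat_def)
  have Az: "A (Suc m) = 0" by (simp add: A_def coeff_rat_def)
  \<comment> \<open>The summands have the odd factors of \<open>b k\<close> but even factors with
    base \<open>Suc M\<close>. The term \<open>k = 0\<close> already equals
    \<open>B 0 * b 0\<close>; the others are moved to base \<open>M\<close> at the cost of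
    \<open>\<mu>\<close>.\<close>
  have R2: "f_tilde_rat m (i + 2) x y
      = (\<Sum>k\<le>Suc m. B k * b k) + (\<Sum>k\<le>m. B (Suc k) * (\<mu> k * e k))"
  proof -
    have "f_tilde_rat m (i + 2) x y
        = (\<Sum>k\<le>m. B k * (odd_factor (2*m + (i + 2) - k) x * even_factor (Suc M) k y))"
      by (simp add: f_tilde_rat_def B_def M_def mult.assoc)
    also have "\<dots> = (\<Sum>k\<le>Suc m. B k * (odd_factor (2*m + (i
        + 2) - k) x * even_factor (Suc M) k y))"
      by (simp add: Bz)
    also have "\<dots> = B 0 * b 0 + (\<Sum>k\<le>m. B (Suc k) * (odd_factor (m
        + M - k) x * even_factor (Suc M) (Suc k) y))"
      by (subst sum.atMost_Suc_shift) (simp add: b_def M_def mult_2 add.assoc)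
    also have "(\<Sum>k\<le>m. B (Suc k) * (odd_factor (m
        + M - k) x * even_factor (Suc M) (Suc k) y))
        = (\<Sum>k\<le>m. B (Suc k) * b (Suc k) + B (Suc k) * (\<mu> k * e k))"
    proof (rule sum.cong[OF refl])
      fix k assume "k \<in> {..m}"
      then have "y^2 * e k = b (Suc k) + of_nat (M - k)^2 * e k" using by' by simp
      moreover have "odd_factor (m + M - k) x * even_factor (Suc M) (Suc k) y
          = (y^2 - of_nat (M+1)^2) * e k"
        by (simp add: even_factor_Suc_Suc e_def algebra_simps)
      ultimately have "odd_factor (m + M - k) x * even_factor (Suc M) (Suc k) y
          = b (Suc k) + \<mu> k * e k"
        by (simp add: \<mu>_def algebra_simps)
      then show "B (Suc k) * (odd_factor (m + M - k) x * even_factor (Suc M) (Suc k) y)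
          = B (Suc k) * b (Suc k) + B (Suc k) * (\<mu> k * e k)"
        by (simp add: distrib_left)
    qed
    also have "B 0 * b 0 + \<dots>
        = (\<Sum>k\<le>Suc m. B k * b k) + (\<Sum>k\<le>m. B (Suc k) * (\<mu> k * e k))"
      by (subst sum.atMost_Suc_shift) (simp add: sum.distrib)
    finally show ?thesis .
  qed
  have S: "(x^2 + y^2 - of_nat (i + 1)^2 - of_nat (i + m + 2)^2) * (\<Sum>k\<le>m. A k * e k)
     = (\<Sum>k\<le>m. A k * b k) + (\<Sum>k\<le>m. A k * b (Suc k))
         + (\<Sum>k\<le>m. A k * (\<nu> k * e k))"
    unfolding sum_distrib_left sum.distrib[symmetric]
  proof (rule sum.cong[OF refl])
    fix k assume "k \<in> {..m}"
    then have k: "k \<le> m" by simp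
    have "(x^2 + y^2 - of_nat (i + 1)^2 - of_nat (i + m + 2)^2) * e k
        = b k + b (Suc k) + \<nu> k * e k"
      using bx[OF k] by'[OF k] by (simp only: \<nu>_def ring_distribs)
    then show "(x^2 + y^2 - of_nat (i + 1)^2 - of_nat (i + m + 2)^2) * (A k * e k)
        = A k * b k + A k * b (Suc k) + A k * (\<nu> k * e k)"
      by (metis (no_types, opaque_lifting) distrib_left mult.left_commute)
  qed
  \<comment> \<open>\<open>\<nu> k\<close> and \<open>\<mu> k\<close> share the factor
    \<open>w\<close>, with cofactors \<open>2 * (m - k)\<close> and \<open>- (k + 1)\<close>. What
    remains is the ratio of two binomial coefficients.\<close>
  have E: "A k * \<nu> k = 2 * (B (Suc k) * \<mu> k)" if "k \<le> m" for k
  proof -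
    define s where "s = m - k"
    have m: "m = k + s" using that by (simp add: s_def)
    have ch: "of_nat (Suc k) * of_nat (m choose Suc k) = (of_nat s * of_nat (m choose k) :: rat)"
      using arg_cong[OF Suc_times_choose_Suc[of k m], where f = "of_nat :: nat \<Rightarrow> rat"]
      by (simp only: of_nat_mult s_def)
    define D :: rat where "D = (-1)^(k+m) * fact m * 2^m / odd_prod (M - k) m"
    define w :: rat where "w = 2 * of_nat i + of_nat m + 3 + of_nat s"
    have A': "A k = D * of_nat (m choose k)" and B': "B (Suc k) = - (D * of_nat (m choose Suc k))"
      using that by (simp_all add: A_def B_def coeff_rat_def D_def M_def)
    have \<nu>': "\<nu> k = of_nat s * (2 * w)"
      using that unfolding \<nu>_def M_def m w_def by (simp add: power2_eq_square algebra_simps)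
    have \<mu>': "\<mu> k = - (of_nat (Suc k) * w)"
      using that unfolding \<mu>_def M_def m w_def by (simp add: power2_eq_square algebra_simps)
    have "A k * \<nu> k = 2 * D * w * (of_nat s * of_nat (m choose k))"
      unfolding A' \<nu>' by simp
    also have "\<dots> = 2 * (B (Suc k) * \<mu> k)"
      unfolding B' \<mu>' ch[symmetric] by simp
    finally show ?thesis .
  qed
  have B0: "of_nat (2*i+1) * C 0 = of_nat (2*(m+1)) * (A 0 - 2 * B 0)"
    using coeff_rec[of 0 m i] by (simp add: A_def B_def C_def)
  have BS: "of_nat (2*i+1) * C (Suc k)
      = of_nat (2*(m+1)) * (A (Suc k) + A k - 2 * B (Suc k))" if "k \<le> m" for k
    using coeff_rec[of "Suc k" m i] that by (simp add: A_def B_def C_def)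
  have "of_nat (2*i+1) * (\<Sum>k\<le>Suc m. C k * b k)
      = of_nat (2*i+1) * C 0 * b 0 + (\<Sum>k\<le>m. of_nat (2*i+1) * C (Suc k) * b (Suc k))"
    by (subst sum.atMost_Suc_shift) (simp only: distrib_left sum_distrib_left mult.assoc)
  also have "\<dots> = of_nat (2*(m+1)) * (A 0 * b 0 + (\<Sum>k\<le>m. A (Suc k) * b (Suc k))
      + (\<Sum>k\<le>m. A k * b (Suc k))
       - 2 * (B 0 * b 0 + (\<Sum>k\<le>m. B (Suc k) * b (Suc k))))"
  proof -
    have "(\<Sum>k\<le>m. of_nat (2*i+1) * C (Suc k) * b (Suc k))
        = (\<Sum>k\<le>m. of_nat (2*(m+1)) * (A (Suc k) + A k - 2 * B (Suc k)) * b (Suc k))"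
      by (intro sum.cong refl) (simp only: BS atMost_iff)
    also have "\<dots> = of_nat (2*(m+1)) * ((\<Sum>k\<le>m. A (Suc k) * b (Suc k))
        + (\<Sum>k\<le>m. A k * b (Suc k)) - 2 * (\<Sum>k\<le>m. B (Suc k) * b (Suc k)))"
      by (simp only: sum_distrib_left sum.distrib[symmetric] sum_subtractf[symmetric] ring_distribs mult.assoc)
    finally show ?thesis
      unfolding B0 by (simp only:) (simp add: algebra_simps)
  qed
  also have "A 0 * b 0 + (\<Sum>k\<le>m. A (Suc k) * b (Suc k)) = (\<Sum>k\<le>m. A k * b k)"
    by (subst sum.atMost_Suc_shift[symmetric, of "\<lambda>k. A k * b k"]) (simp add: Az)
  also have "B 0 * b 0 + (\<Sum>k\<le>m. B (Suc k) * b (Suc k)) = (\<Sum>k\<le>Suc m. B k * b k)"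
    by (rule sum.atMost_Suc_shift[symmetric])
  finally have main: "of_nat (2*i+1) * (\<Sum>k\<le>Suc m. C k * b k)
      = of_nat (2*(m+1)) * ((\<Sum>k\<le>m. A k * b k) + (\<Sum>k\<le>m. A k * b (Suc k))
       - 2 * (\<Sum>k\<le>Suc m. B k * b k))" .
  have "(\<Sum>k\<le>m. A k * (\<nu> k * e k)) = 2 * (\<Sum>k\<le>m. B (Suc k) * (\<mu> k * e k))"
    unfolding sum_distrib_left
  proof (rule sum.cong[OF refl])
    fix k assume "k \<in> {..m}"
    then show "A k * (\<nu> k * e k) = 2 * (B (Suc k) * (\<mu> k * e k))"
      using E[of k] by (simp add: mult.assoc[symmetric])
  qed
  then show ?thesis
    unfolding L R1 R2 main S by (simp add: algebra_simps)
qed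

section \<open>The extreme line \<open>x + y = m\<close>\<close>

text \<open>An \<open>m\<close>-th finite difference. Pascal's rule turns the next difference of
  \<open>g\<close> into the \<open>m\<close>-th difference of \<open>g(r) - g(r + 1)\<close>, where
  the leading terms cancel.\<close>

lemma alternating_sum_poly:
  fixes g :: "'a::idom poly"
  assumes "degree g < m"
  shows "(\<Sum>r\<le>m. (-1)^r * of_nat (m choose r) * poly g (of_nat r)) = 0"
  using assms
proof (induction m arbitrary: g)
  case (Suc m)
  define h where "h = g - pcompose g [:1, 1:]"
  have h: "poly h (of_nat r) = poly g (of_nat r) - poly g (of_nat (Suc r))" for r
    by (simp add: h_def poly_pcompose)
  let ?f = "\<lambda>r. (-1)^r * of_nat (m choose r) * poly g (of_nat r)"
  let ?f' = "\<lambda>r. (-1)^r * of_nat (m choose r) * poly g (of_nat (Suc r))"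
  have "(\<Sum>r\<le>Suc m. (-1)^r * of_nat (Suc m choose r) * poly g (of_nat r))
      = poly g 0 + (\<Sum>r\<le>m. ?f (Suc r) - ?f' r)"
  proof -
    have "(-1)^Suc r * of_nat (Suc m choose Suc r) * poly g (of_nat (Suc r))
        = ?f (Suc r) - ?f' r" for r
      by (simp add: algebra_simps)
    then show ?thesis
      by (subst sum.atMost_Suc_shift) (simp only:, simp add: binomial_eq_0)
  qed
  also have "\<dots> = (\<Sum>r\<le>Suc m. ?f r) - (\<Sum>r\<le>m. ?f' r)"
    by (subst sum.atMost_Suc_shift) (simp add: sum_subtractf binomial_eq_0)
  also have "\<dots> = (\<Sum>r\<le>m. (-1)^r * of_nat (m choose r) * poly h (of_nat r))"
    by (simp add: h right_diff_distrib sum_subtractf binomial_eq_0)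
  also have "\<dots> = 0"
  proof (cases "h = 0")
    case False
    have "degree g \<noteq> 0"
    proof
      assume "degree g = 0"
      then have "h = 0" by (auto simp: h_def elim: degree_eq_zeroE)
      with False show False by simp
    qed
    moreover have "degree h \<le> degree g"
      unfolding h_def by (rule degree_diff_le) (simp_all add: degree_pcompose)
    moreover have "coeff h (degree g) = 0"
      using lead_coeff_comp[of "[:1, 1:]" g] by (simp add: h_def degree_pcompose)
    then have "degree h \<noteq> degree g"
      using False by (metis leading_coeff_0_iff)
    ultimately show ?thesis
      using Suc.prems by (intro Suc.IH) simp
  qed simp
  finally show ?case .
qed simp

text \<open>Since \<open>q\<close> is monic, subtracting the multiple kills the coefficient at
  \<open>degree q\<close>; a nonzero difference would have more roots than its degree.\<close>

lemma poly_eq_smult_of_roots: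
  fixes p q :: "'a::idom poly"
  assumes "lead_coeff q = 1" "degree p \<le> degree q" "finite A" "card A = degree q"
    and "\<And>a. a \<in> A \<Longrightarrow> poly p a
        = 0" "\<And>a. a \<in> A \<Longrightarrow> poly q a = 0"
  shows "p = smult (coeff p (degree q)) q"
proof (rule ccontr)
  define d where "d = p - smult (coeff p (degree q)) q"
  assume "\<not> ?thesis"
  then have d0: "d \<noteq> 0" by (simp add: d_def)
  have "degree d \<le> degree q"
    unfolding d_def using assms(2) by (intro degree_diff_le) auto
  moreover have "coeff d (degree q) = 0"
    using assms(1) unfolding d_def coeff_diff coeff_smult by (simp only: mult_1_right diff_self)
  ultimately have "degree d < degree q"
    using d0 by (metis le_neq_implies_less leading_coeff_0_iff)
  moreover have "card A \<le> card {x. poly d x = 0}"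
    using assms(5,6) by (intro card_mono poly_roots_finite d0) (auto simp: d_def)
  ultimately show False
    using card_poly_roots_bound[OF d0] assms(4) by simp
qed

text \<open>On the line \<open>x + y
    = m\<close> the two products in every term overlap so that a factor
  independent of \<open>k\<close> splits off; the remaining sum is this polynomial.\<close>

definition line_poly :: "nat \<Rightarrow> nat \<Rightarrow> rat poly" where
  "line_poly m i = (\<Sum>k\<le>m. smult (coeff_rat m i k)
     (falling_fact [:of_nat (2*m + i - k), 1:] (2*m)))"

lemma poly_line_poly:
  "poly (line_poly m i) x = (\<Sum>k\<le>m. coeff_rat m i k * falling_fact (of_nat (2*m
      + i - k) + x) (2*m))"
  by (simp add: line_poly_def poly_sum poly_falling_fact)

text \<open>The substitution \<open>k = m - r\<close> gives the alternating binomial shape of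
  \<open>alternating_sum_poly\<close>.\<close>

lemma poly_line_poly':
  "poly (line_poly m i) x = fact m * 2^m * (\<Sum>r\<le>m. (-1)^r * of_nat (m choose r) *
     (falling_fact (of_nat (m + i + r) + x) (2*m) / odd_prod (i + r) m))"
proof -
  have "poly (line_poly m i) x = (\<Sum>r\<le>m. coeff_rat m i (m - r) *
      falling_fact (of_nat (2*m + i - (m - r)) + x) (2*m))"
    unfolding poly_line_poly
    by (rule sum.reindex_bij_witness[of _ "\<lambda>r. m - r" "\<lambda>r. m - r"]) auto
  also have "\<dots> = (\<Sum>r\<le>m. fact m * 2^m * ((-1)^r * of_nat (m choose r) *
     (falling_fact (of_nat (m + i + r) + x) (2*m) / odd_prod (i + r) m)))"
  proof (rule sum.cong[OF refl])
    fix r assume "r \<in> {..m}"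
    then have r: "r \<le> m" by simp
    have "even (m - r + m) = even r" using r by simp
    then have "(-1)^(m - r + m) = ((-1)^r :: rat)" by (metis minus_one_power_iff)
    moreover have "m + i - (m - r) = i + r" "2*m + i - (m - r) = m + i + r"
      using r by auto
    ultimately show "coeff_rat m i (m - r) * falling_fact (of_nat (2*m + i - (m - r)) + x) (2*m)
       = fact m * 2^m * ((-1)^r * of_nat (m choose r) *
     (falling_fact (of_nat (m + i + r) + x) (2*m) / odd_prod (i + r) m))"
      using r by (simp add: coeff_rat_def binomial_symmetric[symmetric] add_ac)
  qed
  finally show ?thesis by (simp add: sum_distrib_left)
qed

lemma degree_line_poly: "degree (line_poly m i) \<le> 2*m"
  unfolding line_poly_def by (intro degree_sum_le) (auto intro: order.trans[OF degree_smult_le])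

text \<open>Each summand vanishes on its own: its \<open>2*m\<close> descending factors start at the
  integer \<open>m + r - t\<close>, which lies between \<open>0\<close> and \<open>2*m - 1\<close>,
  so one of them is \<open>0\<close>.\<close>

lemma line_poly_root_int:
  assumes "1 \<le> t" "t \<le> m"
  shows "poly (line_poly m i) (- of_nat (i + t)) = 0"
proof -
  have "falling_fact (of_nat (m + i + r) + - of_nat (i + t)) (2*m) = (0 :: rat)"
      if "r \<le> m" for r
  proof -
    have "of_nat (m + i + r) + - of_nat (i + t) = (of_nat (m + r - t) :: rat)" "m + r - t < 2*m"
      using assms that by (auto simp: of_nat_diff)
    then show ?thesis
      by (simp only: falling_fact_eq_0)
  qed
  then show ?thesis
    unfolding poly_line_poly' by simp
qed

text \<open>Puts the denominators on the half-integers, where they cancel against falling factorials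
  at half-integer arguments.\<close>

lemma odd_prod_eq_falling_fact:
  "odd_prod s m = (2::rat)^(m+1) * falling_fact (of_nat s + 1/2 + of_nat m) (m + 1)"
proof (induction m)
  case (Suc m)
  have "falling_fact (of_nat s + 1/2 + of_nat (Suc m)) (Suc m + 1)
      = (of_nat s + 1/2 + of_nat (Suc m)) * falling_fact (of_nat s + 1/2 + of_nat m :: rat) (m + 1)"
    unfolding add_Suc by (subst falling_fact_Suc_left) (simp add: algebra_simps)
  then show ?case
    by (simp add: odd_prod_Suc Suc algebra_simps)
qed (simp add: odd_prod_def falling_fact_Suc algebra_simps)

text \<open>Here the numerator contains all factors of the denominator, and the quotient is a
  polynomial in \<open>r\<close> of degree \<open>m - 1\<close>, which the \<open>m\<close>-th
  difference annihilates.\<close>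

lemma line_poly_root_half:
  assumes "a < m"
  shows "poly (line_poly m i) (of_nat a + 1/2) = 0"
proof -
  define g :: "rat poly" where "g = smult (1 / 2^(m+1))
    (falling_fact [:of_nat i + 1/2 + of_nat a + of_nat m, 1:] a *
     falling_fact [:of_nat i - 1/2, 1:] (m - 1 - a))"
  have g: "falling_fact (of_nat (m + i + r) + (of_nat a + 1/2)) (2*m) / odd_prod (i + r) m
      = poly g (of_nat r)" for r
  proof -
    \<comment> \<open>The middle \<open>m + 1\<close> factors are those of
      \<open>odd_prod (i + r) m\<close> up to a power of two; \<open>a\<close> factors precede them
      and \<open>m - 1 - a\<close> follow.\<close>
    have m2: "2*m = a + ((m + 1) + (m - 1 - a))" using assms by simp
    have "falling_fact (of_nat (m + i + r) + (of_nat a + 1/2)) (2*m)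
      = falling_fact (of_nat i + 1/2 + of_nat a + of_nat m + of_nat r) a *
        (falling_fact (of_nat (i + r) + 1/2 + of_nat m) (m + 1) *
         falling_fact (of_nat i - 1/2 + of_nat r) (m - 1 - a) :: rat)"
      unfolding m2 falling_fact_add by (simp add: algebra_simps)
    moreover have "falling_fact (of_nat (i + r) + 1/2 + of_nat m) (m + 1) \<noteq> (0 :: rat)"
      using odd_prod_nonzero[of "i + r" m, where 'a = rat] unfolding odd_prod_eq_falling_fact
          by auto
    ultimately show ?thesis
      unfolding odd_prod_eq_falling_fact g_def by (simp add: poly_falling_fact field_simps)
  qed
  have "degree g \<le> a + (m - 1 - a)"
    unfolding g_def by (rule order.trans[OF degree_smult_le])
      (rule order.trans[OF degree_mult_le], simp)
  then have "(\<Sum>r\<le>m. (-1)^r * of_nat (m choose r) * poly g (of_nat r)) = 0"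
    using assms by (intro alternating_sum_poly) auto
  then show ?thesis
    unfolding poly_line_poly' g by simp
qed

text \<open>The \<open>m\<close> negative integers and \<open>m\<close> positive half-integers found
  above exhaust the degree. The constant \<open>c\<close> can stay unspecified, as antisymmetry is
  insensitive to it.\<close>

lemma line_poly_eq:
  obtains c where "line_poly m i =
    smult c (falling_fact [:of_nat (m + i), 1:] m * falling_fact [:-1/2, 1:] m)"
proof -
  let ?q = "falling_fact [:of_nat (m + i), 1:] m * falling_fact [:-1/2, 1:] m :: rat poly"
  define A B :: "rat set"
    where "A = (\<lambda>t. - of_nat (i + t)) ` {1..m}" and "B
        = (\<lambda>a. of_nat a + 1/2) ` {..<m}"
  have "lead_coeff ?q = 1"
    by (simp only: lead_coeff_mult monic_falling_fact_linear mult_1_left)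
  have deg: "degree ?q = 2*m"
    by (subst degree_mult_eq) (auto simp: falling_fact_linear_nonzero)
  have "x < 0" if "x \<in> A" for x
    using that by (auto simp: A_def simp del: of_nat_add)
  moreover have "x > 0" if "x \<in> B" for x
    using that by (auto simp: B_def intro: add_nonneg_pos)
  ultimately have "A \<inter> B = {}" by fastforce
  moreover have "card A = m" "card B = m" "finite A" "finite B"
    by (auto simp: A_def B_def card_image inj_on_def)
  ultimately have card: "finite (A \<union> B)" "card (A \<union> B) = degree ?q"
    unfolding deg by (simp_all add: card_Un_disjoint)
  have "line_poly m i = smult (coeff (line_poly m i) (degree ?q)) ?q"
  proof (rule poly_eq_smult_of_roots[OF \<open>lead_coeff ?q = 1\<close> _ card])
    show "degree (line_poly m i) \<le> degree ?q"
      unfolding deg by (rule degree_line_poly)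
    fix x assume x: "x \<in> A \<union> B"
    then show "poly (line_poly m i) x = 0"
      using line_poly_root_int line_poly_root_half by (auto simp: A_def B_def simp del: of_nat_add)
    show "poly ?q x = 0"
    proof (cases "x \<in> A")
      case True
      then obtain t where t: "1 \<le> t" "t \<le> m" "x = - of_nat (i + t)" by (auto simp: A_def)
      then have "of_nat (m + i) + x = of_nat (m - t)" by (simp add: of_nat_diff)
      then have "falling_fact (of_nat (m + i) + x) m = 0"
        using t by (simp only: falling_fact_eq_0)
      then show ?thesis by (simp add: poly_falling_fact)
    next
      case False
      then obtain a where "a < m" "x = of_nat a + 1/2" using x by (auto simp: B_def)
      then show ?thesis by (simp add: poly_falling_fact falling_fact_eq_0)
    qed
  qed
  then show ?thesis by (rule that)
qed

text \<open>Reflection turns both \<open>y\<close>-products into \<open>x\<close>-products. One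
  continues the odd factor downwards; the other fills the gap up to \<open>x + i\<close>, which
  makes a factor independent of \<open>k\<close>.\<close>

lemma odd_factor_times_even_factor_on_line:
  assumes "k \<le> m"
  shows "odd_factor (2*m + i - k) x * even_factor (m + i) k (of_nat m - x) =
    falling_fact (x + of_nat i) (2*(m + i) + 1) * falling_fact (of_nat (2*m + i - k) + x) (2*m)"
proof -
  define s where "s = m + i - k"
  have s: "of_nat s = of_nat m + of_nat i - (of_nat k :: 'a)"
    using assms by (simp add: s_def of_nat_diff)
  have n: "2*m + i - k = m + s"
    using assms by (simp add: s_def)
  have "falling_fact (of_nat m - x + of_nat (m + i)) k
      = (-1)^k * falling_fact (x - of_nat (m + s) - 1) k"
    by (subst falling_fact_reflect) (simp add: s algebra_simps)
  moreover have "falling_fact (of_nat m - x - of_nat (m + i) + of_nat k - 1) k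
      = (-1)^k * falling_fact (x + of_nat i) k"
    by (subst falling_fact_reflect) (simp add: algebra_simps)
  ultimately have E: "even_factor (m + i) k (of_nat m - x)
      = falling_fact (x - of_nat (m + s) - 1) k * falling_fact (x + of_nat i) k"
    by (simp add: even_factor_def mult_ac flip: power_mult_distrib)
  have "2*(m + i) + 1 = k + (2 * s + 1 + k)"
    using assms by (simp add: s_def)
  then have R: "falling_fact (x + of_nat i) (2*(m + i) + 1) =
      falling_fact (x + of_nat i) k * falling_fact (x + of_nat i - of_nat k) (2 * s + 1 + k)"
    by (simp only: falling_fact_add)
  have "odd_factor (m + s) x * falling_fact (x - of_nat (m + s) - 1) k
      = falling_fact (x + of_nat (m + s)) ((2*(m+s)+1) + k)"
    unfolding odd_factor_def by (subst falling_fact_add[of _ "2*(m+s)+1"]) (simp add: algebra_simps)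
  also have "(2*(m+s)+1) + k = 2*m + (2 * s + 1 + k)" by simp
  also have "falling_fact (x + of_nat (m + s)) \<dots> =
      falling_fact (x + of_nat (m + s)) (2*m) * falling_fact (x + of_nat i - of_nat k) (2 * s
          + 1 + k)"
    by (subst falling_fact_add) (simp add: s algebra_simps)
  finally have "odd_factor (m + s) x * falling_fact (x - of_nat (m
      + s) - 1) k * falling_fact (x + of_nat i) k
      = falling_fact (x + of_nat (m + s)) (2*m) * falling_fact (x + of_nat i - of_nat k) (2 * s
          + 1 + k)
        * falling_fact (x + of_nat i) k"
    by (rule arg_cong)
  then show ?thesis
    unfolding n E R by (simp only: mult_ac add_ac)
qed

lemma f_tilde_rat_on_line:
  "f_tilde_rat m i x (of_nat m - x) =
     falling_fact (x + of_nat i) (2*(m + i) + 1) * poly (line_poly m i) x"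
  unfolding f_tilde_rat_def poly_line_poly sum_distrib_left
  using odd_factor_times_even_factor_on_line[of _ m i x] by (intro sum.cong) (simp_all add: mult_ac)

text \<open>All factors form two runs centred at \<open>x = m/2\<close>, of lengths
  \<open>m + 2*M + 1\<close> and \<open>m\<close>. Under \<open>x -> m - x\<close> they acquire the
  signs \<open>(-1)^(m+1)\<close> and \<open>(-1)^m\<close>, whose product is
  \<open>-1\<close>.\<close>

lemma f_tilde_rat_antisym_on_line:
  "f_tilde_rat m i (of_nat m - x) x = - f_tilde_rat m i x (of_nat m - x)"
proof -
  obtain c where c: "line_poly m i
      = smult c (falling_fact [:of_nat (m + i), 1:] m * falling_fact [:-1/2, 1:] m)"
    by (rule line_poly_eq)
  define M where "M = m + i"
  have F: "f_tilde_rat m i x (of_nat m - x)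
      = c * falling_fact (x + of_nat M) (m + (2*M + 1)) * falling_fact (x - 1/2) m" for x
  proof -
    have "falling_fact (x + of_nat M) (m + (2*M + 1))
        = falling_fact (of_nat (m + i) + x) m * falling_fact (x + of_nat i) (2*(m+i) + 1)"
      unfolding falling_fact_add[of _ m] M_def by (simp add: algebra_simps)
    then show ?thesis
      unfolding f_tilde_rat_on_line c by (simp add: poly_falling_fact)
  qed
  have 1: "falling_fact (of_nat m - x + of_nat M) (m + (2*M + 1))
      = (-1)^(m+1) * falling_fact (x + of_nat M) (m + (2*M + 1))"
  proof -
    have "(-1)^(m + (2*M + 1)) = ((-1)^(m+1) :: rat)"
      by (simp add: power_add power_mult)
    moreover have "of_nat (m + (2*M + 1)) - 1 - (of_nat m - x + of_nat M) = x + of_nat M"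
      by simp
    ultimately show ?thesis
      using falling_fact_reflect[of "of_nat m - x + of_nat M" "m + (2*M + 1)"] by (simp only:)
  qed
  have 2: "falling_fact (of_nat m - x - 1/2) m = (-1)^m * falling_fact (x - 1/2) m"
    by (subst falling_fact_reflect) (simp add: algebra_simps)
  have "(-1)^(m+1) * (-1)^m = (-1::rat)" 
    by (simp flip: power_mult_distrib)
  then show ?thesis
    using F[of x] F[of "of_nat m - x"] unfolding 1 2 by (simp add: mult_ac)
qed

section \<open>Beta integrals and identification of the coefficients\<close>

lemma interval_integrable_continuous_UNIV: 
  fixes a b :: real and f :: "real \<Rightarrow> real"
  assumes "continuous_on UNIV f"
  shows "interval_lebesgue_integrable lborel (ereal a) (ereal b) f"
  using assms by (intro interval_integrable_isCont) (simp add: continuous_on_eq_continuous_at)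

text \<open>Splitting off one factor \<open>t^2 - x^2\<close> expresses the integral through those
  for \<open>(n + 1, m)\<close> and \<open>(n, m)\<close>, hence the induction over arbitrary
  \<open>n\<close>.\<close>

lemma interval_integral_even_power:
  "(LBINT t=0..x. t^(2*n) * (t^2 - x^2)^m)
     = (-1)^m * fact m * 2^m / odd_prod n m * (x :: real)^(2*n + 2*m + 1)"
proof (induction m arbitrary: n)
  case 0
  have "(LBINT t=ereal 0..ereal x. t^(2*n)) = x^(2*n+1) / (2*n+1) - 0^(2*n+1) / (2*n+1)"
  proof (rule interval_integral_FTC_finite)
    show "((\<lambda>t. t^(2*n+1) / (2*n+1)) has_vector_derivative t^(2*n)) (at t within S)"
        for t :: real and S
      unfolding has_real_derivative_iff_has_vector_derivative[symmetric]
      by (rule derivative_eq_intros refl | simp)+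
  qed (intro continuous_intros)
  then show ?case
    by (simp add: odd_prod_def zero_ereal_def)
next
  case (Suc m)
  have "(LBINT t=0..x. t^(2*n) * (t^2 - x^2)^Suc m)
      = (LBINT t=0..x. t^(2*Suc n) * (t^2 - x^2)^m - x^2 * (t^2 - x^2)^m * t^(2*n))"
    by (simp add: algebra_simps power2_eq_square)
  also have "\<dots> = (LBINT t=0..x. t^(2*Suc n) * (t^2 - x^2)^m)
      - x^2 * (LBINT t=0..x. t^(2*n) * (t^2 - x^2)^m)"
  proof -
    have "(LBINT t=0..x. t^(2*Suc n) * (t^2 - x^2)^m - x^2 * (t^2 - x^2)^m * t^(2*n))
       = (LBINT t=0..x. t^(2*Suc n) * (t^2 - x^2)^m - x^2 * (t^(2*n) * (t^2 - x^2)^m))"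
      by (simp only: mult_ac)
    also have "\<dots> = (LBINT t=0..x. t^(2*Suc n) * (t^2 - x^2)^m)
        - (LBINT t=0..x. x^2 * (t^(2*n) * (t^2 - x^2)^m))"
      unfolding zero_ereal_def by (intro interval_lebesgue_integral_diff(2)
          interval_integrable_continuous_UNIV continuous_intros)
    finally show ?thesis by (simp only: interval_lebesgue_integral_mult_right)
  qed
  also have "\<dots> = (-1)^m * fact m * 2^m * (1 / odd_prod (Suc n) m
      - 1 / odd_prod n m) * x^(2*n + 2*Suc m + 1)"
    unfolding Suc by (simp add: algebra_simps power2_eq_square)
  \<comment> \<open>Over the common denominator the numerators differ by
    \<open>(2*n + 1) - (2*(n + m) + 3)\<close>, which supplies the new factor of
    \<open>fact m * 2^m\<close> and the sign.\<close>
  also have "1 / odd_prod (Suc n) m - 1 / odd_prod n m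
      = - (of_nat (2 * Suc m) :: real) / odd_prod n (Suc m)"
  proof -
    have "1 / odd_prod (Suc n) m = (of_nat (2 * n + 1) :: real) / odd_prod n (Suc m)"
      unfolding odd_prod_Suc_left by simp
    moreover have "1 / odd_prod n m = (of_nat (2 * (n + m) + 3) :: real) / odd_prod n (Suc m)"
      unfolding odd_prod_Suc by (simp del: of_nat_add of_nat_mult of_nat_Suc)
    ultimately show ?thesis by (simp flip: diff_divide_distrib)
  qed
  finally show ?case by (simp add: field_simps)
qed

lemma of_rat_odd_prod: "of_rat (odd_prod s m) = (odd_prod s m :: real)"
  unfolding odd_prod_def of_rat_prod of_rat_of_nat_eq ..

lemma of_rat_fact: "of_rat (fact n) = fact n"
  by (metis of_nat_fact of_rat_of_nat_eq)

lemma f_int_eq: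
  "f_int m i x y = (\<Sum>k\<le>m. of_rat (coeff_rat m i k) * x^(2*(2*m+i) - 2*k + 1) * y^(2*k))"
proof -
  have "t^(2*i) * (t^2 - x^2)^m * (t^2 - y^2)^m =
      (\<Sum>k\<le>m. of_nat (m choose k) * (-1)^k * y^(2*k) *
        (t^(2*(i+m-k)) * (t^2 - x^2)^m))" for t
  proof -
    have "(t^2 - y^2)^m = (\<Sum>k\<le>m. of_nat (m choose k) * (-(y^2))^k * (t^2)^(m-k))"
      using binomial_ring[of "-(y^2)" "t^2" m] by simp
    also have "\<dots> = (\<Sum>k\<le>m. of_nat (m choose k) * (-1)^k * y^(2*k) * t^(2*(m-k)))"
      by (intro sum.cong refl) (simp add: power_mult power_minus[of "y^2"])
    finally have "t^(2*i) * (t^2 - x^2)^m * (t^2 - y^2)^m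
       = (\<Sum>k\<le>m. of_nat (m choose k) * (-1)^k * y^(2*k) * ((t^(2*i) * t^(2*(m-k)))
           * (t^2 - x^2)^m))"
      by (simp add: sum_distrib_left mult_ac)
    also have "\<dots> = (\<Sum>k\<le>m. of_nat (m choose k) * (-1)^k * y^(2*k)
        * (t^(2*(i+m-k)) * (t^2 - x^2)^m))"
      by (intro sum.cong refl) (simp add: algebra_simps flip: power_add)
    finally show ?thesis .
  qed
  then have "f_int m i x y = (LBINT t=0..x. (\<Sum>k\<le>m. of_nat (m choose k) * (-1)^k
      * y^(2*k) * (t^(2*(i+m-k)) * (t^2 - x^2)^m)))"
    by (simp add: f_int_def)
  also have "\<dots> = (\<Sum>k\<le>m. LBINT t=0..x. of_nat (m choose k) * (-1)^k * y^(2*k)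
      * (t^(2*(i+m-k)) * (t^2 - x^2)^m))"
    (is "(LBINT t=0..x. (\<Sum>k\<le>m. ?g k t)) = _")
  proof -
    have "(LBINT t=ereal 0..ereal x. (\<Sum>k\<le>n. ?g k t))
        = (\<Sum>k\<le>n. LBINT t=ereal 0..ereal x. ?g k t)" for n
    proof (induction n)
      case (Suc n)
      have "(LBINT t=ereal 0..ereal x. (\<Sum>k\<le>n. ?g k t) + ?g (Suc n) t)
          = (LBINT t=ereal 0..ereal x. (\<Sum>k\<le>n. ?g k t))
              + (LBINT t=ereal 0..ereal x. ?g (Suc n) t)"
        by (intro interval_lebesgue_integral_add(2) interval_integrable_continuous_UNIV
            continuous_intros)
      then show ?case by (simp only: sum.atMost_Suc Suc)
    qed simp
    then show ?thesis by (simp add: zero_ereal_def)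
  qed
  also have "\<dots> = (\<Sum>k\<le>m. of_rat (coeff_rat m i k) * x^(2*(2*m+i) - 2*k
      + 1) * y^(2*k))"
  proof (rule sum.cong[OF refl])
    fix k assume "k \<in> {..m}"
    then have k: "2*(i+m-k) + 2*m + 1 = 2*(2*m+i) - 2*k + 1" by simp
    have "(LBINT t=0..x. ?g k t) = of_nat (m choose k) * (-1)^k * y^(2*k) *
        ((-1)^m * fact m * 2^m / odd_prod (i+m-k) m * x^(2*(2*m+i) - 2*k + 1))"
      by (simp only: interval_lebesgue_integral_mult_right interval_integral_even_power k)
    also have "\<dots> = of_rat (coeff_rat m i k) * x^(2*(2*m+i) - 2*k + 1) * y^(2*k)"
      by (simp add: coeff_rat_def of_rat_mult of_rat_divide of_rat_power of_rat_minus
          of_rat_odd_prod of_rat_fact power_add add.commute)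
    finally show "(LBINT t=0..x. ?g k t)
        = of_rat (coeff_rat m i k) * x^(2*(2*m+i) - 2*k + 1) * y^(2*k)" .
  qed
  finally show ?thesis .
qed

text \<open>Uniqueness resolves the definite description; the values for \<open>k > m\<close> agree
  because \<open>m choose k\<close> is \<open>0\<close> there.\<close>

lemma f_coeff_eq: "f_coeff m i = coeff_rat m i"
proof (rule is_f_coeffs_unique[OF is_f_coeffs_f_coeff])
  show "is_f_coeffs m i (coeff_rat m i)"
    by (simp add: is_f_coeffs_def f_int_eq coeff_rat_def)
qed

section \<open>Vanishing on all lines\<close>

lemma f_tilde_rat_minus: "f_tilde_rat m i (-x) (-y) = - f_tilde_rat m i x y"
  by (simp add: f_tilde_rat_def odd_factor_minus even_factor_minus sum_negf)

text \<open>The induction keeps \<open>i\<close> arbitrary because the recurrence lowers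
  \<open>m\<close> but raises \<open>i\<close>. For \<open>m = 0\<close> only an odd factor is
  left.\<close>

lemma f_tilde_rat_symmetrization_eq_0:
  assumes "x + y = of_int j" "\<bar>j\<bar> \<le> int m"
  shows "f_tilde_rat m i x y + f_tilde_rat m i y x = 0"
  using assms
proof (induction m arbitrary: i)
  case 0
  then have "y = - x" by simp
  then show ?case
    by (simp add: f_tilde_rat_def odd_factor_minus)
next
  case (Suc m)
  consider "\<bar>j\<bar> \<le> int m" | "j = int (Suc m)" | "j = - int (Suc m)"
    using Suc.prems(2) by linarith
  then show ?case
  proof cases
    case 1
    then have "f_tilde_rat m i' x y + f_tilde_rat m i' y x = 0" for i'
      using Suc by blast
    then have IH: "f_tilde_rat m i' y x = - f_tilde_rat m i' x y" for i'
      by (simp add: eq_neg_iff_add_eq_0 add.commute)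
    have "of_nat (2*i + 1) * f_tilde_rat (Suc m) i y x
        = - (of_nat (2*i + 1) * f_tilde_rat (Suc m) i x y)"
      unfolding f_tilde_rat_rec IH by (simp add: algebra_simps)
    then have "of_nat (2*i + 1) * (f_tilde_rat (Suc m) i x y + f_tilde_rat (Suc m) i y x) = 0"
      by (simp only: distrib_left add.right_inverse add.commute)
    then show ?thesis by (auto simp only: mult_eq_0_iff of_nat_eq_0_iff)
  next
    case 2
    then have "y = of_nat (Suc m) - x" using Suc.prems(1) by (simp add: algebra_simps)
    then show ?thesis by (simp only: f_tilde_rat_antisym_on_line add.right_inverse)
  next
    \<comment> \<open>Negating both variables carries this line to the previous one, and
      \<open>f_tilde_rat\<close> is odd under that.\<close>
    case 3
    then have "- y = of_nat (Suc m) - (- x)" using Suc.prems(1) by (simp add: algebra_simps)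
    then have "f_tilde_rat (Suc m) i (-y) (-x) = - f_tilde_rat (Suc m) i (-x) (-y)"
      by (simp only: f_tilde_rat_antisym_on_line)
    then show ?thesis by (simp add: f_tilde_rat_minus)
  qed
qed

section \<open>From vanishing to divisibility\<close>

lemma poly_poly_f_tilde:
  "poly (poly (f_tilde m i P Q) a) r = f_tilde_rat m i (poly (poly P a) r) (poly (poly Q a) r)"
proof -
  have "2*(2*m + i) - 2*k + 1 = 2*(2*m + i - k) + 1" for k by simp
  then show ?thesis
    unfolding f_tilde_def f_tilde_rat_def Let_def poly_sum f_coeff_eq
    by (intro sum.cong refl)
      (simp add: poly_falling_fact odd_factor_def even_factor_def of_nat_diff algebra_simps)
qed

text \<open>Distinct roots split off one by one: the factors already removed are nonzero at the next
  root. A domain is enough, so the coefficients may lie in \<open>\<rat>[x]\<close>.\<close>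

lemma prod_linear_dvd:
  fixes P :: "'a::idom poly"
  assumes "finite J" "inj_on a J" "\<And>j. j \<in> J \<Longrightarrow> poly P (a j) = 0"
  shows "(\<Prod>j\<in>J. [:- a j, 1:]) dvd P"
  using assms
proof (induction J)
  case (insert j J)
  then obtain q where q: "P = (\<Prod>j\<in>J. [:- a j, 1:]) * q"
    by (auto elim: dvdE)
  have "poly (\<Prod>j\<in>J. [:- a j, 1:]) (a j) \<noteq> 0"
    using insert.hyps insert.prems(1) by (auto simp: poly_prod)
  then have "[:- a j, 1:] dvd q"
    using insert.prems(2)[of j] q by (simp add: poly_eq_0_iff_dvd[symmetric])
  then show ?case
    using insert.hyps q by (simp add: mult.commute[of _ q] mult_dvd_mono del: mult_pCons_left)
qed simp

theorem mainTheorem1: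
  fixes i m :: nat
  shows "f_tilde m i X Y + f_tilde m i Y X
           \<in> ideal_generated {falling_fact (X + Y + of_nat m) (2*m + 1)}"
proof -
  interpret module "(*) :: rat poly poly \<Rightarrow> rat poly poly \<Rightarrow> rat poly poly"
    by unfold_locales (simp_all add: algebra_simps)
  let ?P = "f_tilde m i X Y + f_tilde m i Y X"
  \<comment> \<open>The line \<open>x + y = j - m\<close> solved for \<open>y\<close>, as an element
    of \<open>\<rat>[x]\<close>; the shift by \<open>m\<close> lets \<open>j\<close> run over
    \<open>0..2*m\<close>.\<close>
  define a :: "nat \<Rightarrow> rat poly" where "a = (\<lambda>j. [:of_nat j - of_nat m, -1:])"
  have "(\<Prod>j<2*m+1. [:- a j, 1:]) dvd ?P"
  proof (rule prod_linear_dvd)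
    show "inj_on a {..<2*m+1}"
      by (auto simp: inj_on_def a_def)
    fix j assume j: "j \<in> {..<2*m+1}"
    have "poly (poly ?P (a j)) r = 0" for r
    proof -
      have "poly (poly X (a j)) r = r" "poly (poly Y (a j)) r = of_int (int j - int m) - r"
        by (simp_all add: X_def Y_def a_def)
      moreover have "f_tilde_rat m i r (of_int (int j - int m) - r)
          + f_tilde_rat m i (of_int (int j - int m) - r) r = 0"
        using j by (intro f_tilde_rat_symmetrization_eq_0[of _ _ "int j - int m"]) auto
      ultimately show ?thesis
        by (simp add: poly_poly_f_tilde)
    qed
    then show "poly ?P (a j) = 0"
      using poly_all_0_iff_0 by blast
  qed simp
  \<comment> \<open>Each linear factor \<open>Y - a j\<close> is \<open>X + Y + m - j\<close>, the
    \<open>j\<close>-th factor of the falling factorial.\<close>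
  also have "(\<Prod>j<2*m+1. [:- a j, 1:]) = falling_fact (X + Y + of_nat m) (2*m + 1)"
    unfolding falling_fact_def
    by (intro prod.cong refl) (simp add: X_def Y_def a_def of_nat_poly)
  finally obtain q where "?P = falling_fact (X + Y + of_nat m) (2*m + 1) * q"
    by (rule dvdE)
  then show ?thesis
    unfolding span_singleton by (auto simp: mult.commute)
qed

end
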